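(* Consider the P2P market problem and its KKT conditions described in the context, with optimal traded powers $P^{\ast}_{ij}$, transaction prices $\lambda^{\ast}_{ij}$ and total traded powers $P^{\ast}_{i,tr}$. The following statements hold. (i) If no trade weights are imposed, i.e. $d_{ij}=0$ for all $i,j=1,\dots,n$, and the communication graph between successfully traded peers is connected, then all transaction prices are the same and equal to $$\lambda^{\ast}=\frac{\sum_j b_j/(2a_j)}{\sum_j 1/(2a_j)}.$$ The optimal total traded power of each peer is $$P^{\ast}_{i,tr}=\frac{\sum_j b_j/(2a_j)}{2a_i\sum_j 1/(2a_j)}-\frac{b_i}{2a_i}.$$ The indices in these two formulas are taken over the successfully traded peers. Moreover, this optimal price and these optimal total traded powers are the same as the optimal solutions of the pool-based social welfare maximization problem for the $n$ prosumers (see context). (ii) If $d_{ij}=0$ for all $i,j=1,\dots,n$, and the communication graph between successfully traded peers is unconnected, then the P2P market is clustered into smaller P2P markets, each of which has a different energy price. The optimal price and total traded powers of each smaller P2P market are calculated by the same formulas as in (i), with the indices taken over the successfully traded peers of that smaller market. (iii) If $d_{ij}\neq 0$, then the energy prices of successful transactions are different from each other. The optimal total traded powers are computed from $$[E,\alpha]^{T}P^{\ast}_{tr}=\big[\,\mathrm{vec}(b_j+d_{ji}-b_i-d_{ij})^{T},\,0\,\big]^{T},$$ where $P^{\ast}_{tr}=[2a_1P^{\ast}_{1,tr},\dots,2a_nP^{\ast}_{n,tr}]^{T}$, $\alpha=\left[\frac{1}{2a_1},\dots,\frac{1}{2a_n}\right]^{T}$, and $E$ is the incidence matrix of the communicat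ion graph.
   Context: **Market.** There are $n$ prosumers (peers) $1,\dots,n$, communicating through an undirected bipartite graph $\mathcal{G}$ whose two sides are the buyers and the sellers. $\mathcal{N}_i$ is the neighbour set of peer $i$. For $j\in\mathcal{N}_i$, $P_{ij}\in\mathbb{R}$ is the power traded by $i$ with $j$ (positive if $i$ buys from $j$, negative if $i$ sells to $j$); $P_i=(P_{ij})_{j\in\mathcal{N}_i}$, and $P_{i,tr}=\sum_{j\in\mathcal{N}_i}P_{ij}$ is the total traded power of peer $i$. The cost of peer $i$ is $$C_i(P_i)=a_iP_{i,tr}^2+b_iP_{i,tr}+\sum_{j\in\mathcal{N}_i}d_{ij}P_{ij},$$ with $a_i>0$. The numbers $d_{ij}$ are the bilateral trade weights. **P2P market problem.** Minimize $\sum_{i=1}^nC_i(P_i)$ subject to $P_{ij}+P_{ji}=0$ for all $i$ and $j\in\mathcal{N}_i$; $P_{i,tr}^{\min}\le P_{i,tr}\le P_{i,tr}^{\max}$ for all $i$; and $P_{ij}\le0$ (resp. $\ge0$) for all $j\in\mathcal{N}_i$ if $i$ is a seller (resp. buyer). **Pool-based social welfare maximization problem.** Minimize $\sum_{i=1}^{n}C_i(P_{i,tr})$, where $C_i(P_{i,tr})=a_iP_{i,tr}^2+b_iP_{i,tr}$ (no trade weights), subject to $\sum_{i=1}^nP_{i,tr}=0$; $P_{i,tr}^{\min}\le P_{i,tr}\le P_{i,tr}^{\max}$; and $P_{i,tr}\le0$ (resp. $\ge0$) if $i$ is a seller (resp. buyer). Its clearing price is the multiplier of the balance constraint, equal to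 $\partial C_i/\partial P_{i,tr}=2a_iP^{\ast}_{i,tr}+b_i$ at the optimum. **Convention.** To compare the two markets, only the equality constraints of the two problems are considered in the optimality conditions, since the inequality constraints in the two problems are the same. **KKT conditions of the P2P problem.** Let $\lambda_{ij}=\lambda_{ji}$ be the Lagrange multiplier of $P_{ij}+P_{ji}=0$, regarded as the clearing price of the transaction between $i$ and $j$. The conditions are, for all $i$ and all $j\in\mathcal{N}_i$, $P^{\ast}_{ij}+P^{\ast}_{ji}=0$ and $\partial C_i/\partial P_{ij}=\lambda^{\ast}_{ij}$ at $P^{\ast}$, i.e. $$2a_iP^{\ast}_{i,tr}+b_i+d_{ij}=\lambda^{\ast}_{ij}.$$ **Successfully traded peers.** Not all participating peers need trade: a peer is successfully traded if it actually trades power with some neighbour (a peer whose negotiations fail has $P^{\ast}_{i,tr}=0$), and the transactions in which power is actually traded are the successful transactions. The communication graph between successfully traded peers is the graph on these peers whose edges are the successful transactions. **Incidence matrix.** $E$ is taken for an arbitrary edge orientation; the column of an edge oriented as $(i,j)$ has $+1$ in row $i$, $-1$ in row $j$ and $0$ elsewhere. The entry of $\mathrm{vec}(\cdot)$ for that edge is $b_j+d_{ji}-b_i-d_{ij}$. $[E,\alpha]$ is $E$ with the column $\alpha$ appended.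
   Formalization: In (ii) the cluster prices differ for almost every b; in (iii) prices differ off a nowhere dense set of the solvable weights (at one peer: exactly when the weights differ); in (i) the comparison with the pool of all n prosumers is stated for a connected communication graph. *)

theory Defs
  imports "HOL-Analysis.Analysis" "HOL-Library.Disjoint_Sets"
begin

(* Peers are the elements of a finite type 'n.  B is the set of buyers, its complement the set of
   sellers, and N i the set of neighbours of peer i.  The entries P i j, lam i j and d i j
   with j \<notin> N i carry no meaning, and no notion below depends on them. *)

definition p2p_graph :: "'n set \<Rightarrow> ('n \<Rightarrow> 'n set) \<Rightarrow> bool" where
  "p2p_graph B N \<longleftrightarrow>
     (\<forall>i j. j \<in> N i \<longleftrightarrow> i \<in> N j) \<and> (\<forall>i. \<forall>j\<in>N i. i \<in> B \<longleftrightarrow> j \<notin> B)"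

definition traded_power :: "('n \<Rightarrow> 'n set) \<Rightarrow> ('n \<Rightarrow> 'n \<Rightarrow> real) \<Rightarrow> 'n \<Rightarrow> real" where
  "traded_power N P i = (\<Sum>j\<in>N i. P i j)"

definition pool_cost :: "real \<Rightarrow> real \<Rightarrow> real \<Rightarrow> real" where
  "pool_cost ai bi q = ai * q\<^sup>2 + bi * q"

definition p2p_cost ::
  "('n \<Rightarrow> 'n set) \<Rightarrow> ('n \<Rightarrow> real) \<Rightarrow> ('n \<Rightarrow> real) \<Rightarrow> ('n \<Rightarrow> 'n \<Rightarrow> real)
    \<Rightarrow> ('n \<Rightarrow> 'n \<Rightarrow> real) \<Rightarrow> 'n \<Rightarrow> real" where
  "p2p_cost N a b d P i = pool_cost (a i) (b i) (traded_power N P i) + (\<Sum>j\<in>N i. d i j * P i j)"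


(* The P2P market of a set I of peers, with N i \<subseteq> I for i \<in> I.  The whole market is I = UNIV. *)

definition p2p_feasible ::
  "'n set \<Rightarrow> 'n set \<Rightarrow> ('n \<Rightarrow> 'n set) \<Rightarrow> ('n \<Rightarrow> real) \<Rightarrow> ('n \<Rightarrow> real)
    \<Rightarrow> ('n \<Rightarrow> 'n \<Rightarrow> real) \<Rightarrow> bool" where
  "p2p_feasible I B N Pmin Pmax P \<longleftrightarrow>
     (\<forall>i\<in>I. \<forall>j\<in>N i. P i j + P j i = 0) \<and>
     (\<forall>i\<in>I. Pmin i \<le> traded_power N P i \<and> traded_power N P i \<le> Pmax i) \<and>
     (\<forall>i\<in>I. \<forall>j\<in>N i. if i \<in> B then 0 \<le> P i j else P i j \<le> 0)"

definition p2p_optimal ::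
  "'n set \<Rightarrow> 'n set \<Rightarrow> ('n \<Rightarrow> 'n set) \<Rightarrow> ('n \<Rightarrow> real) \<Rightarrow> ('n \<Rightarrow> real) \<Rightarrow> ('n \<Rightarrow> 'n \<Rightarrow> real)
    \<Rightarrow> ('n \<Rightarrow> real) \<Rightarrow> ('n \<Rightarrow> real) \<Rightarrow> ('n \<Rightarrow> 'n \<Rightarrow> real) \<Rightarrow> bool" where
  "p2p_optimal I B N a b d Pmin Pmax P \<longleftrightarrow>
     is_arg_min (\<lambda>P. \<Sum>i\<in>I. p2p_cost N a b d P i) (p2p_feasible I B N Pmin Pmax) P"

(* Only the equality constraints carry multipliers.  The derivative is the partial derivative of
   the cost of peer i with respect to the single entry P i j. *)
definition p2p_kkt ::
  "'n set \<Rightarrow> ('n \<Rightarrow> 'n set) \<Rightarrow> ('n \<Rightarrow> real) \<Rightarrow> ('n \<Rightarrow> real) \<Rightarrow> ('n \<Rightarrow> 'n \<Rightarrow> real)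
    \<Rightarrow> ('n \<Rightarrow> 'n \<Rightarrow> real) \<Rightarrow> ('n \<Rightarrow> 'n \<Rightarrow> real) \<Rightarrow> bool" where
  "p2p_kkt I N a b d P lam \<longleftrightarrow>
     (\<forall>i\<in>I. \<forall>j\<in>N i.
        P i j + P j i = 0 \<and> lam i j = lam j i \<and>
        ((\<lambda>t. p2p_cost N a b d (P(i := (P i)(j := t))) i) has_real_derivative lam i j) (at (P i j)))"

definition p2p_solution ::
  "'n set \<Rightarrow> 'n set \<Rightarrow> ('n \<Rightarrow> 'n set) \<Rightarrow> ('n \<Rightarrow> real) \<Rightarrow> ('n \<Rightarrow> real) \<Rightarrow> ('n \<Rightarrow> 'n \<Rightarrow> real)
    \<Rightarrow> ('n \<Rightarrow> real) \<Rightarrow> ('n \<Rightarrow> real) \<Rightarrow> ('n \<Rightarrow> 'n \<Rightarrow> real) \<Rightarrow> ('n \<Rightarrow> 'n \<Rightarrow> real) \<Rightarrow> bool" where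
  "p2p_solution I B N a b d Pmin Pmax P lam \<longleftrightarrow>
     p2p_optimal I B N a b d Pmin Pmax P \<and> p2p_kkt I N a b d P lam"


(* The pool-based market of a set I of prosumers. *)

definition pool_feasible ::
  "'n set \<Rightarrow> 'n set \<Rightarrow> ('n \<Rightarrow> real) \<Rightarrow> ('n \<Rightarrow> real) \<Rightarrow> ('n \<Rightarrow> real) \<Rightarrow> bool" where
  "pool_feasible I B Pmin Pmax Q \<longleftrightarrow>
     (\<Sum>i\<in>I. Q i) = 0 \<and>
     (\<forall>i\<in>I. Pmin i \<le> Q i \<and> Q i \<le> Pmax i) \<and>
     (\<forall>i\<in>I. if i \<in> B then 0 \<le> Q i else Q i \<le> 0)"

definition pool_optimal ::
  "'n set \<Rightarrow> 'n set \<Rightarrow> ('n \<Rightarrow> real) \<Rightarrow> ('n \<Rightarrow> real) \<Rightarrow> ('n \<Rightarrow> real) \<Rightarrow> ('n \<Rightarrow> real)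
    \<Rightarrow> ('n \<Rightarrow> real) \<Rightarrow> bool" where
  "pool_optimal I B a b Pmin Pmax Q \<longleftrightarrow>
     is_arg_min (\<lambda>Q. \<Sum>i\<in>I. pool_cost (a i) (b i) (Q i)) (pool_feasible I B Pmin Pmax) Q"

(* mu is the multiplier of the balance constraint at Q, again without the inequality constraints. *)
definition pool_price :: "'n set \<Rightarrow> ('n \<Rightarrow> real) \<Rightarrow> ('n \<Rightarrow> real) \<Rightarrow> ('n \<Rightarrow> real) \<Rightarrow> real \<Rightarrow> bool" where
  "pool_price I a b Q mu \<longleftrightarrow>
     (\<forall>i\<in>I. (pool_cost (a i) (b i) has_real_derivative mu) (at (Q i)))"


definition traded :: "('n \<Rightarrow> 'n set) \<Rightarrow> ('n \<Rightarrow> 'n \<Rightarrow> real) \<Rightarrow> 'n \<Rightarrow> 'n \<Rightarrow> bool" where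
  "traded N P i j \<longleftrightarrow> j \<in> N i \<and> P i j \<noteq> 0"

definition traded_peers :: "'n set \<Rightarrow> ('n \<Rightarrow> 'n set) \<Rightarrow> ('n \<Rightarrow> 'n \<Rightarrow> real) \<Rightarrow> 'n set" where
  "traded_peers I N P = {i\<in>I. \<exists>j. traded N P i j}"

(* For a symmetric relation R that relates elements of V only to elements of V. *)
definition connected_graph :: "'n set \<Rightarrow> ('n \<Rightarrow> 'n \<Rightarrow> bool) \<Rightarrow> bool" where
  "connected_graph V R \<longleftrightarrow> V \<noteq> {} \<and> (\<forall>i\<in>V. \<forall>j\<in>V. R\<^sup>*\<^sup>* i j)"

(* The connected components of the graph of the successful transactions. *)
definition trade_clusters :: "('n \<Rightarrow> 'n set) \<Rightarrow> ('n \<Rightarrow> 'n \<Rightarrow> real) \<Rightarrow> 'n set set" where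
  "trade_clusters N P = (\<lambda>i. {j. (traded N P)\<^sup>*\<^sup>* i j}) ` traded_peers UNIV N P"

definition trade_prices ::
  "('n \<Rightarrow> 'n set) \<Rightarrow> ('n \<Rightarrow> 'n \<Rightarrow> real) \<Rightarrow> ('n \<Rightarrow> 'n \<Rightarrow> real) \<Rightarrow> 'n set \<Rightarrow> real set" where
  "trade_prices N P lam C = {lam i j | i j. i \<in> C \<and> traded N P i j}"

definition submarket :: "('n \<Rightarrow> 'n set) \<Rightarrow> 'n set \<Rightarrow> 'n \<Rightarrow> 'n set" where
  "submarket N C i = N i \<inter> C"

definition price_formula :: "('n \<Rightarrow> real) \<Rightarrow> ('n \<Rightarrow> real) \<Rightarrow> 'n set \<Rightarrow> real" where
  "price_formula a b S = (\<Sum>j\<in>S. b j / (2 * a j)) / (\<Sum>j\<in>S. 1 / (2 * a j))"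

definition power_formula :: "('n \<Rightarrow> real) \<Rightarrow> ('n \<Rightarrow> real) \<Rightarrow> 'n set \<Rightarrow> 'n \<Rightarrow> real" where
  "power_formula a b S i =
     (\<Sum>j\<in>S. b j / (2 * a j)) / (2 * a i * (\<Sum>j\<in>S. 1 / (2 * a j))) - b i / (2 * a i)"


(* Prices of different clusters, or of different weighted transactions, can coincide for
   exceptional data (two disjoint trading pairs with the same coefficients, or the same weight
   on all edges).  "Different" therefore means different outside an exceptional set of the data,
   and the following sets collect the data for which a coincidence occurs. *)

definition cluster_price_ties ::
  "'n::finite set \<Rightarrow> ('n \<Rightarrow> 'n set) \<Rightarrow> ('n \<Rightarrow> real) \<Rightarrow> ('n \<Rightarrow> 'n \<Rightarrow> real)
    \<Rightarrow> ('n \<Rightarrow> real) \<Rightarrow> ('n \<Rightarrow> real) \<Rightarrow> (real ^ 'n) set" where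
  "cluster_price_ties B N a d Pmin Pmax =
     {b. \<exists>P lam. p2p_solution UNIV B N a (($) b) d Pmin Pmax P lam \<and>
           (\<exists>C\<in>trade_clusters N P. \<exists>D\<in>trade_clusters N P.
              C \<noteq> D \<and> trade_prices N P lam C \<inter> trade_prices N P lam D \<noteq> {})}"

(* The stationarity conditions on the edges of a cycle of the graph restrict the weights, so the
   weights that admit a solution need not have nonempty interior.  This is why price ties are
   compared with this set and not with the space of all weights. *)
definition solvable_weights ::
  "'n::finite set \<Rightarrow> ('n \<Rightarrow> 'n set) \<Rightarrow> ('n \<Rightarrow> real) \<Rightarrow> ('n \<Rightarrow> real)
    \<Rightarrow> ('n \<Rightarrow> real) \<Rightarrow> ('n \<Rightarrow> real) \<Rightarrow> (real ^ 'n ^ 'n) set" where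
  "solvable_weights B N a b Pmin Pmax =
     {d. (\<exists>i. \<exists>j\<in>N i. d $ i $ j \<noteq> 0) \<and>
         (\<exists>P lam. p2p_solution UNIV B N a b (\<lambda>i j. d $ i $ j) Pmin Pmax P lam)}"

definition transaction_price_ties ::
  "'n::finite set \<Rightarrow> ('n \<Rightarrow> 'n set) \<Rightarrow> ('n \<Rightarrow> real) \<Rightarrow> ('n \<Rightarrow> real)
    \<Rightarrow> ('n \<Rightarrow> real) \<Rightarrow> ('n \<Rightarrow> real) \<Rightarrow> (real ^ 'n ^ 'n) set" where
  "transaction_price_ties B N a b Pmin Pmax =
     {d \<in> solvable_weights B N a b Pmin Pmax.
        \<exists>P lam. p2p_solution UNIV B N a b (\<lambda>i j. d $ i $ j) Pmin Pmax P lam \<and>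
          (\<exists>i j k l. traded N P i j \<and> traded N P k l \<and> {i, j} \<noteq> {k, l} \<and> lam i j = lam k l)}"

definition nowhere_dense_in :: "'a::topological_space set \<Rightarrow> 'a set \<Rightarrow> bool" where
  "nowhere_dense_in X A \<longleftrightarrow>
     (top_of_set X) interior_of ((top_of_set X) closure_of A) = {}"


(* edge e = (i, j) if the edge with index e is oriented from i to j.  Every edge of the
   graph occurs exactly once, in one of its two orientations. *)
definition edge_orientation :: "('n \<Rightarrow> 'n set) \<Rightarrow> ('e \<Rightarrow> 'n \<times> 'n) \<Rightarrow> bool" where
  "edge_orientation N edge \<longleftrightarrow>
     (\<forall>e. snd (edge e) \<in> N (fst (edge e))) \<and>
     (\<forall>i. \<forall>j\<in>N i. \<exists>!e. edge e = (i, j) \<or> edge e = (j, i))"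

definition incidence_matrix :: "('e::finite \<Rightarrow> 'n \<times> 'n) \<Rightarrow> real ^ 'e ^ 'n::finite" where
  "incidence_matrix edge =
     (\<chi> i e. if i = fst (edge e) then 1 else if i = snd (edge e) then - 1 else 0)"

definition edge_vec ::
  "('e::finite \<Rightarrow> 'n \<times> 'n) \<Rightarrow> ('n \<Rightarrow> real) \<Rightarrow> ('n \<Rightarrow> 'n \<Rightarrow> real) \<Rightarrow> real ^ 'e" where
  "edge_vec edge b d = (\<chi> e. case edge e of (i, j) \<Rightarrow> b j + d j i - b i - d i j)"

(* The appended column (entry) has index None. *)
definition append_column ::
  "real ^ 'e ^ 'n \<Rightarrow> real ^ 'n \<Rightarrow> real ^ ('e::finite option) ^ 'n::finite" where
  "append_column E v = (\<chi> i c. case c of None \<Rightarrow> v $ i | Some e \<Rightarrow> E $ i $ e)"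

definition append_entry :: "real ^ 'e \<Rightarrow> real \<Rightarrow> real ^ ('e::finite option)" where
  "append_entry v z = (\<chi> c. case c of None \<Rightarrow> z | Some e \<Rightarrow> v $ e)"

end

(* On every edge the KKT conditions say that the price is the marginal cost 2 a_i T_i + b_i plus the
   weight d_ij, where T_i is the total traded power.  Without weights the marginal cost is therefore
   constant along trades, and the balance of the powers of a set closed under trading determines
   this constant; convexity of the costs turns the stationarity conditions into optimality, for the
   pool and for each cluster.  Two given clusters have the same price only if b lies on a
   hyperplane.  For the weighted problem, the T_i are unique and depend continuously on the weights
   that admit a solution, hence so do the prices. *)
theory Submission
  imports Defs
begin

section \<open>Symmetric neighbourhoods and the balance of traded powers\<close>

text \<open>Relative to \<open>I\<close>, so that the same lemmas serve the whole graph and the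
  submarket of a single cluster.\<close>

definition market :: "'n set \<Rightarrow> ('n \<Rightarrow> 'n set) \<Rightarrow> bool" where
  "market I N \<longleftrightarrow> (\<forall>i\<in>I. \<forall>j\<in>N i. j \<in> I \<and> i \<in> N j)"

lemma market_UNIV: "p2p_graph B N \<Longrightarrow> market UNIV N"
  by (auto simp: p2p_graph_def market_def)

lemma market_submarket: "market UNIV N \<Longrightarrow> market C (submarket N C)"
  by (auto simp: market_def submarket_def)

text \<open>Reversing edges permutes the ordered pairs in \<open>Sigma I N\<close>, so the sum
  equals its own negative. Both the balance of powers and the cancellation of price terms come from
  this.\<close>

lemma sum_edges_antisym:
  fixes g :: "'n::finite \<Rightarrow> 'n \<Rightarrow> real"
  assumes "market I N" and "\<And>i j. i \<in> I \<Longrightarrow> j \<in> N i \<Longrightarrow> g j i = - g i j"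
  shows "(\<Sum>i\<in>I. \<Sum>j\<in>N i. g i j) = 0"
proof -
  have "(\<Sum>(i,j)\<in>Sigma I N. g i j) = (\<Sum>(i,j)\<in>Sigma I N. - g i j)"
  proof (rule sum.reindex_bij_witness[where i = prod.swap and j = prod.swap])
    fix p assume "p \<in> Sigma I N"
    then show "(case prod.swap p of (i, j) \<Rightarrow> - g i j) = (case p of (i, j) \<Rightarrow> g i j)"
      using assms(2) by (metis (no_types, lifting) SigmaE2 minus_minus case_prod_conv surj_pair swap_simp)
  qed (use assms(1) in \<open>auto simp: market_def\<close>)
  then have "(\<Sum>(i,j)\<in>Sigma I N. g i j) = 0"
    by (simp add: split_def sum_negf)
  then show ?thesis
    by (simp add: sum.Sigma)
qed

lemma sum_traded_power:
  fixes N :: "'n::finite \<Rightarrow> 'n set"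
  assumes "market I N" and "\<And>i j. i \<in> I \<Longrightarrow> j \<in> N i \<Longrightarrow> P i j + P j i = 0"
  shows "(\<Sum>i\<in>I. traded_power N P i) = 0"
  unfolding traded_power_def
  by (rule sum_edges_antisym) (use assms in \<open>auto simp: algebra_simps eq_neg_iff_add_eq_0\<close>)

section \<open>Stationarity and optimality in the P2P market\<close>

lemma pool_cost_has_derivative:
  "(pool_cost ai bi has_real_derivative 2 * ai * q + bi) (at q)"
  unfolding pool_cost_def by (auto intro!: derivative_eq_intros)

text \<open>The second-order Taylor expansion is exact for a quadratic. Cost differences thus become
  identities whose remainder is a weighted square, which gives uniqueness as well as
  optimality.\<close>

lemma pool_cost_expand:
  "pool_cost ai bi q' = pool_cost ai bi q + (2 * ai * q + bi) * (q' - q) + ai * (q' - q)\<^sup>2"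
  by (simp add: pool_cost_def power2_eq_square algebra_simps)

lemma p2p_cost_has_derivative:
  fixes N :: "'n::finite \<Rightarrow> 'n set"
  assumes "j \<in> N i"
  shows "((\<lambda>t. p2p_cost N a b d (P(i := (P i)(j := t))) i) has_real_derivative
           2 * a i * traded_power N P i + b i + d i j) (at (P i j))"
proof -
  let ?r = "\<Sum>k\<in>N i - {j}. P i k" and ?s = "\<Sum>k\<in>N i - {j}. d i k * P i k"
  have T: "traded_power N (P(i := (P i)(j := t))) i = t + ?r" for t
    unfolding traded_power_def by (subst sum.remove[OF _ assms]) (auto intro!: sum.cong)
  have D: "(\<Sum>k\<in>N i. d i k * (P(i := (P i)(j := t))) i k) = d i j * t + ?s" for t
    by (subst sum.remove[OF _ assms]) (auto intro!: sum.cong)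
  have "traded_power N P i = P i j + ?r"
    using T[of "P i j"] by simp
  then show ?thesis
    unfolding p2p_cost_def T D pool_cost_def
    by (auto intro!: derivative_eq_intros simp: algebra_simps)
qed

text \<open>By uniqueness of derivatives the KKT conditions become linear equations, and all later
  arguments use them in this form.\<close>

lemma p2p_kkt_iff:
  fixes N :: "'n::finite \<Rightarrow> 'n set"
  shows "p2p_kkt I N a b d P lam \<longleftrightarrow>
    (\<forall>i\<in>I. \<forall>j\<in>N i. P i j + P j i = 0 \<and> lam i j = lam j i \<and>
       lam i j = 2 * a i * traded_power N P i + b i + d i j)"
proof -
  have "((\<lambda>t. p2p_cost N a b d (P(i := (P i)(j := t))) i) has_real_derivative lam i j) (at (P i j))
      \<longleftrightarrow> lam i j = 2 * a i * traded_power N P i + b i + d i j" if "j \<in> N i" for i j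
    using p2p_cost_has_derivative[of j N i a b d P] that DERIV_unique by auto
  then show ?thesis
    by (simp add: p2p_kkt_def)
qed

lemma p2p_kkt_edge:
  fixes N :: "'n::finite \<Rightarrow> 'n set"
  assumes "p2p_kkt I N a b d P lam" "i \<in> I" "j \<in> N i"
  shows "P j i = - P i j" "lam j i = lam i j"
    and "lam i j = 2 * a i * traded_power N P i + b i + d i j"
proof -
  have "P i j + P j i = 0" "lam i j = lam j i"
    and *: "lam i j = 2 * a i * traded_power N P i + b i + d i j"
    using assms unfolding p2p_kkt_iff by blast+
  then show "P j i = - P i j" "lam j i = lam i j"
    by linarith+
  show "lam i j = 2 * a i * traded_power N P i + b i + d i j"
    by (rule *)
qed

lemma p2p_feasible_edge:
  assumes "p2p_feasible I B N Pmin Pmax P" "i \<in> I" "j \<in> N i"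
  shows "P j i = - P i j"
proof -
  have "P i j + P j i = 0"
    using assms unfolding p2p_feasible_def by blast
  then show ?thesis
    by linarith
qed

text \<open>By the exact expansion, the cost of a feasible \<open>P'\<close> exceeds that of
  \<open>P\<close> by first-order terms \<open>lam i j * (P' i j - P i j)\<close> and nonnegative
  squares. The first-order terms cancel on each edge, since prices are symmetric and feasible trades
  antisymmetric.\<close>

lemma p2p_optimal_if_kkt:
  fixes N :: "'n::finite \<Rightarrow> 'n set"
  assumes "market I N" "\<And>i. i \<in> I \<Longrightarrow> 0 \<le> a i"
    and feas: "p2p_feasible I B N Pmin Pmax P" and kkt: "p2p_kkt I N a b d P lam"
  shows "p2p_optimal I B N a b d Pmin Pmax P"
proof -
  have "(\<Sum>i\<in>I. p2p_cost N a b d P i) \<le> (\<Sum>i\<in>I. p2p_cost N a b d P' i)"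
    if "p2p_feasible I B N Pmin Pmax P'" for P'
  proof -
    let ?T = "traded_power N P" and ?T' = "traded_power N P'"
    have "p2p_cost N a b d P' i
        = p2p_cost N a b d P i + a i * (?T' i - ?T i)\<^sup>2 + (\<Sum>j\<in>N i. lam i j * (P' i j - P i j))"
      if "i \<in> I" for i
    proof -
      have "(\<Sum>j\<in>N i. lam i j * (P' i j - P i j))
          = (\<Sum>j\<in>N i. (2 * a i * ?T i + b i) * (P' i j - P i j) + (d i j * P' i j - d i j * P i j))"
      proof (intro sum.cong refl)
        fix j assume "j \<in> N i"
        then have "lam i j = 2 * a i * ?T i + b i + d i j"
          by (rule p2p_kkt_edge[OF kkt that])
        then show "lam i j * (P' i j - P i j)
            = (2 * a i * ?T i + b i) * (P' i j - P i j) + (d i j * P' i j - d i j * P i j)"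
          by (simp add: algebra_simps)
      qed
      also have "\<dots> = (2 * a i * ?T i + b i) * (?T' i - ?T i)
          + ((\<Sum>j\<in>N i. d i j * P' i j) - (\<Sum>j\<in>N i. d i j * P i j))"
        by (simp only: sum.distrib sum_subtractf traded_power_def flip: sum_distrib_left)
      finally show ?thesis
        using pool_cost_expand[of "a i" "b i" "?T' i" "?T i"]
        by (simp add: p2p_cost_def)
    qed
    moreover have "(\<Sum>i\<in>I. \<Sum>j\<in>N i. lam i j * (P' i j - P i j)) = 0"
    proof (rule sum_edges_antisym[OF \<open>market I N\<close>])
      fix i j assume ij: "i \<in> I" "j \<in> N i"
      then have "lam j i = lam i j" "P j i = - P i j" "P' j i = - P' i j"
        using p2p_kkt_edge[OF kkt ij] p2p_feasible_edge[OF that ij] by auto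
      then show "lam j i * (P' j i - P j i) = - (lam i j * (P' i j - P i j))"
        by (simp add: algebra_simps)
    qed
    ultimately have "(\<Sum>i\<in>I. p2p_cost N a b d P' i)
        = (\<Sum>i\<in>I. p2p_cost N a b d P i) + (\<Sum>i\<in>I. a i * (?T' i - ?T i)\<^sup>2)"
      by (simp add: sum.distrib)
    then show ?thesis
      using assms(2) by (simp add: sum_nonneg)
  qed
  then show ?thesis
    using feas by (auto simp: p2p_optimal_def is_arg_min_def not_less)
qed

text \<open>To exhibit a solution, for a submarket or for shifted weights, it now suffices to check
  constraints and linear equations; no minimization has to be repeated.\<close>

lemma p2p_solution_iff:
  fixes N :: "'n::finite \<Rightarrow> 'n set"
  assumes "market I N" "\<And>i. i \<in> I \<Longrightarrow> 0 \<le> a i"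
  shows "p2p_solution I B N a b d Pmin Pmax P lam \<longleftrightarrow>
    p2p_feasible I B N Pmin Pmax P \<and> p2p_kkt I N a b d P lam"
  using p2p_optimal_if_kkt[OF assms]
  by (auto simp: p2p_solution_def p2p_optimal_def is_arg_min_def)

section \<open>Closed formulas for price and power, and the pool market\<close>

text \<open>Solve each equation for \<open>T i\<close> and sum over \<open>C\<close>: the balance
  eliminates the powers and leaves one linear equation for \<open>mu\<close>, whose coefficient is
  positive because \<open>C\<close> is nonempty.\<close>

lemma formulas_if_equal_marginal_cost:
  fixes T :: "'n::finite \<Rightarrow> real"
  assumes "\<And>i. a i > 0" "C \<noteq> {}" and bal: "(\<Sum>i\<in>C. T i) = 0"
    and mu: "\<And>i. i \<in> C \<Longrightarrow> 2 * a i * T i + b i = mu"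
  shows "mu = price_formula a b C" and "i \<in> C \<Longrightarrow> T i = power_formula a b C i"
proof -
  let ?s = "\<Sum>j\<in>C. 1 / (2 * a j)"
  have pos: "?s > 0"
    using assms by (intro sum_pos) auto
  have T: "T i = mu / (2 * a i) - b i / (2 * a i)" if "i \<in> C" for i
    using mu[OF that] assms(1)[of i] by (auto simp: field_simps)
  have "0 = (\<Sum>j\<in>C. mu * (1 / (2 * a j)) - b j / (2 * a j))"
    using bal T by simp
  then have "mu * ?s = (\<Sum>j\<in>C. b j / (2 * a j))"
    by (simp add: sum_subtractf sum_distrib_left)
  then show *: "mu = price_formula a b C"
    using pos by (simp add: price_formula_def field_simps)
  show "T i = power_formula a b C i" if "i \<in> C"
    using T[OF that] * by (simp add: power_formula_def price_formula_def mult.commute)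
qed

text \<open>With a common marginal cost \<open>mu\<close>, the linear part of the cost difference is
  \<open>mu\<close> times a difference of two zero balances. What remains is a sum of squares with
  positive weights, so \<open>T\<close> is the only minimizer up to values outside
  \<open>I\<close>.\<close>

lemma pool_optimal_iff:
  fixes T :: "'n::finite \<Rightarrow> real"
  assumes a: "\<And>i. a i > 0" and feas: "pool_feasible I B Pmin Pmax T"
    and mu: "\<And>i. i \<in> I \<Longrightarrow> 2 * a i * T i + b i = mu"
  shows "pool_optimal I B a b Pmin Pmax Q \<longleftrightarrow> (\<forall>i\<in>I. Q i = T i)"
proof -
  let ?c = "\<lambda>Q. \<Sum>i\<in>I. pool_cost (a i) (b i) (Q i)"
  have cost: "?c Q = ?c T + (\<Sum>i\<in>I. a i * (Q i - T i)\<^sup>2)" if "pool_feasible I B Pmin Pmax Q" for Q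
  proof -
    have "?c Q = (\<Sum>i\<in>I. pool_cost (a i) (b i) (T i) + mu * (Q i - T i) + a i * (Q i - T i)\<^sup>2)"
      by (intro sum.cong refl) (metis mu pool_cost_expand)
    also have "\<dots> = ?c T + mu * ((\<Sum>i\<in>I. Q i) - (\<Sum>i\<in>I. T i)) + (\<Sum>i\<in>I. a i * (Q i - T i)\<^sup>2)"
      by (simp only: sum.distrib sum_subtractf flip: sum_distrib_left)
    finally show ?thesis
      using that feas by (simp add: pool_feasible_def)
  qed
  show ?thesis
  proof
    assume Q: "pool_optimal I B a b Pmin Pmax Q"
    then have "pool_feasible I B Pmin Pmax Q" "?c Q \<le> ?c T"
      using feas by (auto simp: pool_optimal_def is_arg_min_def not_less)
    then have "(\<Sum>i\<in>I. a i * (Q i - T i)\<^sup>2) \<le> 0"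
      using cost by simp
    then have "(\<Sum>i\<in>I. a i * (Q i - T i)\<^sup>2) = 0"
      using a by (intro antisym sum_nonneg) (auto simp: less_imp_le)
    then have "\<forall>i\<in>I. a i * (Q i - T i)\<^sup>2 = 0"
      by (subst (asm) sum_nonneg_eq_0_iff) (use a in \<open>auto simp: less_imp_le\<close>)
    then show "\<forall>i\<in>I. Q i = T i"
      using a by (metis eq_iff_diff_eq_0 less_irrefl mult_eq_0_iff power_eq_0_iff)
  next
    assume Q: "\<forall>i\<in>I. Q i = T i"
    then have "pool_feasible I B Pmin Pmax Q" "?c Q = ?c T"
      using feas by (auto simp: pool_feasible_def)
    moreover have "?c T \<le> ?c Q'" if "pool_feasible I B Pmin Pmax Q'" for Q'
      using cost[OF that] a by (simp add: sum_nonneg less_imp_le)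
    ultimately show "pool_optimal I B a b Pmin Pmax Q"
      by (auto simp: pool_optimal_def is_arg_min_def not_less)
  qed
qed

lemma connected_graph_const:
  assumes "connected_graph V R" "\<And>i j. R i j \<Longrightarrow> f i = f j" "i \<in> V" "j \<in> V"
  shows "f i = f j"
proof -
  have "R\<^sup>*\<^sup>* i j"
    using assms by (auto simp: connected_graph_def)
  then show ?thesis
    by (induction rule: rtranclp_induct) (use assms(2) in auto)
qed

lemma traded_sym:
  assumes "market UNIV N" "p2p_kkt UNIV N a b d P lam" "traded N P i j"
  shows "traded N P j i"
  using assms by (fastforce simp: market_def p2p_kkt_def traded_def)

text \<open>Restricting the neighbours to a set closed under trading drops only zero trades, so the
  balance of the submarket is a balance of the original powers.\<close>

lemma sum_traded_power_closed:
  fixes N :: "'n::finite \<Rightarrow> 'n set"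
  assumes "market UNIV N" "p2p_kkt UNIV N a b d P lam"
    and closed: "\<forall>i\<in>C. \<forall>j. traded N P i j \<longrightarrow> j \<in> C"
  shows "i \<in> C \<Longrightarrow> traded_power (submarket N C) P i = traded_power N P i"
    and "(\<Sum>i\<in>C. traded_power N P i) = 0"
proof -
  show *: "traded_power (submarket N C) P i = traded_power N P i" if "i \<in> C" for i
    unfolding traded_power_def submarket_def
    by (rule sum.mono_neutral_left) (use closed that in \<open>auto simp: traded_def\<close>)
  have "(\<Sum>i\<in>C. traded_power (submarket N C) P i) = 0"
    by (rule sum_traded_power[OF market_submarket[OF assms(1)]])
      (use assms(2) in \<open>auto simp: p2p_kkt_def submarket_def\<close>)
  then show "(\<Sum>i\<in>C. traded_power N P i) = 0"
    using * by simp
qed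

text \<open>Without weights the marginal costs at both ends of an edge equal its price; connectivity
  spreads this value over \<open>C\<close>, and the balance of \<open>C\<close> identifies it.
  Applied to all traded peers and to each cluster.\<close>

lemma closed_connected_prices:
  fixes N :: "'n::finite \<Rightarrow> 'n set"
  assumes "market UNIV N" and a: "\<And>i. a i > 0" and kkt: "p2p_kkt UNIV N a b d P lam"
    and d: "\<forall>i. \<forall>j\<in>N i. d i j = 0"
    and closed: "\<forall>i\<in>C. \<forall>j. traded N P i j \<longrightarrow> j \<in> C"
    and conn: "connected_graph C (traded N P)" and "i \<in> C"
  shows "2 * a i * traded_power N P i + b i = price_formula a b C"
    and "traded_power N P i = power_formula a b C i"
    and "traded N P i j \<Longrightarrow> lam i j = price_formula a b C"
proof -
  let ?u = "\<lambda>i. 2 * a i * traded_power N P i + b i"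
  have edge: "?u i = ?u j" if "traded N P i j" for i j
  proof -
    have "j \<in> N i" "i \<in> N j"
      using that assms(1) by (auto simp: traded_def market_def)
    then show ?thesis
      using p2p_kkt_edge(2,3)[OF kkt UNIV_I] d by (metis add_0_right)
  qed
  have const: "?u k = ?u i" if "k \<in> C" for k
    by (rule connected_graph_const[where f = ?u, OF conn edge]) (use that \<open>i \<in> C\<close> in auto)
  have "C \<noteq> {}" and "(\<Sum>i\<in>C. traded_power N P i) = 0"
    using \<open>i \<in> C\<close> sum_traded_power_closed(2)[OF assms(1) kkt closed] by auto
  note F = formulas_if_equal_marginal_cost[where a = a and b = b and T = "traded_power N P", OF a this const]
  show u: "?u i = price_formula a b C"
    by (rule F)
  show "traded_power N P i = power_formula a b C i"
    using F(2) \<open>i \<in> C\<close> by blast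
  show "lam i j = price_formula a b C" if "traded N P i j"
    using that p2p_kkt_edge(3)[OF kkt UNIV_I] u d by (auto simp: traded_def)
qed

section \<open>Clusters of trading peers\<close>

lemma rtranclp_traded_peers:
  assumes "market UNIV N" "p2p_kkt UNIV N a b d P lam"
    and "i \<in> traded_peers UNIV N P" "(traded N P)\<^sup>*\<^sup>* i j"
  shows "j \<in> traded_peers UNIV N P"
  using assms(4,3) by induction (use traded_sym[OF assms(1,2)] in \<open>auto simp: traded_peers_def\<close>)

lemma rtranclp_traded_sym:
  assumes "market UNIV N" "p2p_kkt UNIV N a b d P lam" "(traded N P)\<^sup>*\<^sup>* i j"
  shows "(traded N P)\<^sup>*\<^sup>* j i"
  by (rule sympD[OF sympI[THEN symp_rtranclp]])
    (use traded_sym[OF assms(1,2)] assms(3) in auto)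

text \<open>A nonzero trade is nonzero from both ends, so reachability by trades is an equivalence
  relation, and the clusters are its classes on the traded peers.\<close>

lemma partition_on_trade_clusters:
  assumes "market UNIV N" "p2p_kkt UNIV N a b d P lam"
  shows "partition_on (traded_peers UNIV N P) (trade_clusters N P)"
proof (rule partition_onI)
  show "\<Union> (trade_clusters N P) = traded_peers UNIV N P"
    using rtranclp_traded_peers[OF assms] by (auto simp: trade_clusters_def)
next
  fix C D assume "C \<in> trade_clusters N P" "D \<in> trade_clusters N P" "C \<noteq> D"
  then show "disjnt C D"
    unfolding trade_clusters_def disjnt_def
    using rtranclp_traded_sym[OF assms] rtranclp_trans[of "traded N P"] by blast
qed (auto simp: trade_clusters_def)

lemma trade_cluster_closed:
  assumes "C \<in> trade_clusters N P"
  shows "\<forall>i\<in>C. \<forall>j. traded N P i j \<longrightarrow> j \<in> C"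
  using assms by (auto simp: trade_clusters_def)

lemma trade_cluster_connected:
  assumes "market UNIV N" "p2p_kkt UNIV N a b d P lam" "C \<in> trade_clusters N P"
  shows "connected_graph C (traded N P)"
proof -
  obtain c where C: "C = {j. (traded N P)\<^sup>*\<^sup>* c j}"
    using assms(3) by (auto simp: trade_clusters_def)
  then have "c \<in> C" by simp
  moreover have "(traded N P)\<^sup>*\<^sup>* i j" if "i \<in> C" "j \<in> C" for i j
    using that C rtranclp_traded_sym[OF assms(1,2)] by (metis mem_Collect_eq rtranclp_trans)
  ultimately show ?thesis
    by (auto simp: connected_graph_def)
qed

text \<open>A path of trades that starts in a closed set never leaves it, so it survives the
  restriction of the neighbourhoods.\<close>

lemma connected_submarket:
  assumes conn: "connected_graph C (traded N P)"
    and closed: "\<forall>i\<in>C. \<forall>j. traded N P i j \<longrightarrow> j \<in> C"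
  shows "connected_graph C (traded (submarket N C) P)"
proof -
  have "j \<in> C \<and> (traded (submarket N C) P)\<^sup>*\<^sup>* i j" if "(traded N P)\<^sup>*\<^sup>* i j" "i \<in> C" for i j
    using that
  proof (induction rule: rtranclp_induct)
    case (step y z)
    then have "z \<in> C" "traded (submarket N C) P y z"
      using closed by (auto simp: traded_def submarket_def)
    with step show ?case
      by (auto intro: rtranclp.rtrancl_into_rtrancl)
  qed simp
  then show ?thesis
    using conn unfolding connected_graph_def by blast
qed

lemma two_le_card_trade_clusters:
  fixes N :: "'n::finite \<Rightarrow> 'n set"
  assumes "traded_peers UNIV N P \<noteq> {}" "\<not> connected_graph (traded_peers UNIV N P) (traded N P)"
  shows "2 \<le> card (trade_clusters N P)"
proof -
  obtain i j where ij: "i \<in> traded_peers UNIV N P" "j \<in> traded_peers UNIV N P"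
      "\<not> (traded N P)\<^sup>*\<^sup>* i j"
    using assms by (auto simp: connected_graph_def)
  let ?C = "\<lambda>i. {j. (traded N P)\<^sup>*\<^sup>* i j}"
  have "?C i \<noteq> ?C j"
    using ij by auto
  then have "card {?C i, ?C j} = 2"
    by simp
  moreover have "{?C i, ?C j} \<subseteq> trade_clusters N P"
    using ij by (auto simp: trade_clusters_def)
  ultimately show ?thesis
    by (metis card_mono finite)
qed

text \<open>The traded powers do not change under the restriction, so constraints and KKT equations
  are inherited; optimality within the submarket then follows from convexity.\<close>

lemma submarket_solution:
  fixes N :: "'n::finite \<Rightarrow> 'n set"
  assumes m: "market UNIV N" and a: "\<And>i. a i > 0"
    and sol: "p2p_solution UNIV B N a b d Pmin Pmax P lam"
    and closed: "\<forall>i\<in>C. \<forall>j. traded N P i j \<longrightarrow> j \<in> C"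
  shows "p2p_solution C B (submarket N C) a b d Pmin Pmax P lam"
proof -
  have feas: "p2p_feasible UNIV B N Pmin Pmax P" and kkt: "p2p_kkt UNIV N a b d P lam"
    using sol a p2p_solution_iff[OF m, of a] by (auto simp: less_imp_le)
  note T = sum_traded_power_closed(1)[OF m kkt closed]
  have "p2p_feasible C B (submarket N C) Pmin Pmax P"
    using feas T by (auto simp: p2p_feasible_def submarket_def)
  moreover have "p2p_kkt C (submarket N C) a b d P lam"
    unfolding p2p_kkt_iff
  proof (intro ballI)
    fix i j assume "i \<in> C" "j \<in> submarket N C i"
    then have "j \<in> N i"
      by (simp add: submarket_def)
    with kkt show "P i j + P j i = 0 \<and> lam i j = lam j i \<and>
        lam i j = 2 * a i * traded_power (submarket N C) P i + b i + d i j"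
      unfolding T[OF \<open>i \<in> C\<close>] p2p_kkt_iff by blast
  qed
  ultimately show ?thesis
    using a p2p_solution_iff[OF market_submarket[OF m], of C a] by (simp add: less_imp_le)
qed

section \<open>Exceptional coefficients for the cluster prices\<close>

text \<open>The price formula is linear in \<open>b\<close>, with a coefficient vector supported on
  the set of peers. For disjoint sets the two vectors differ, so equality of prices cuts out a
  hyperplane.\<close>

lemma closed_negligible_price_hyperplane:
  fixes C D :: "'n::finite set"
  assumes a: "\<And>i. a i > 0" and "C \<noteq> {}" "C \<inter> D = {}"
  shows "closed {v :: real ^ 'n. price_formula a (($) v) C = price_formula a (($) v) D}"
    and "negligible {v :: real ^ 'n. price_formula a (($) v) C = price_formula a (($) v) D}"
proof -
  define w :: "'n set \<Rightarrow> real ^ 'n" where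
    "w A = (\<chi> i. if i \<in> A then 1 / (2 * a i) / (\<Sum>j\<in>A. 1 / (2 * a j)) else 0)" for A
  have w: "price_formula a (($) v) A = w A \<bullet> v" for v A
  proof -
    have "w A \<bullet> v = (\<Sum>i\<in>UNIV. if i \<in> A then v $ i / (2 * a i) / (\<Sum>j\<in>A. 1 / (2 * a j)) else 0)"
      unfolding inner_vec_def by (intro sum.cong) (auto simp: w_def)
    also have "\<dots> = price_formula a (($) v) A"
      by (simp add: price_formula_def sum.If_cases sum_divide_distrib)
    finally show ?thesis ..
  qed
  have *: "{v. price_formula a (($) v) C = price_formula a (($) v) D} = {v. (w C - w D) \<bullet> v = 0}"
    by (simp add: w inner_diff_left)
  \<comment> \<open>At such a coordinate \<open>w C\<close> is positive while \<open>w D\<close>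
    vanishes.\<close>
  obtain i where i: "i \<in> C"
    using assms by auto
  have "(\<Sum>j\<in>C. 1 / (2 * a j)) > 0"
    using a i by (intro sum_pos) auto
  then have "w C $ i \<noteq> 0" "w D $ i = 0"
    using i assms(3) less_imp_neq[OF a[of i]] by (auto simp: w_def)
  then have "w C - w D \<noteq> 0"
    by (metis eq_iff_diff_eq_0)
  then show "negligible {v :: real ^ 'n. price_formula a (($) v) C = price_formula a (($) v) D}"
    unfolding * by (intro negligible_hyperplane) simp
  show "closed {v :: real ^ 'n. price_formula a (($) v) C = price_formula a (($) v) D}"
    unfolding * by (rule closed_hyperplane)
qed

lemma negligible_closure_cluster_price_ties:
  fixes N :: "'n::finite \<Rightarrow> 'n set"
  assumes m: "market UNIV N" and a: "\<And>i. a i > 0" and d: "\<forall>i. \<forall>j\<in>N i. d i j = 0"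
  shows "negligible (closure (cluster_price_ties B N a d Pmin Pmax))"
proof -
  define H where "H = (\<lambda>(C, D). {v :: real ^ 'n. price_formula a (($) v) C = price_formula a (($) v) D})"
  define K where "K = {(C, D). C \<noteq> {} \<and> C \<inter> D = ({} :: 'n set)}"
  have H: "closed (H p) \<and> negligible (H p)" if "p \<in> K" for p
  proof -
    obtain C D where "p = (C, D)" "C \<noteq> {}" "C \<inter> D = {}"
      using \<open>p \<in> K\<close> by (auto simp: K_def)
    with closed_negligible_price_hyperplane[where a = a, OF a, of C D] show ?thesis
      by (simp add: H_def)
  qed
  have "cluster_price_ties B N a d Pmin Pmax \<subseteq> (\<Union>p\<in>K. H p)"
  proof
    fix v assume "v \<in> cluster_price_ties B N a d Pmin Pmax"
    then obtain P lam C D p where sol: "p2p_solution UNIV B N a (($) v) d Pmin Pmax P lam"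
      and CD: "C \<in> trade_clusters N P" "D \<in> trade_clusters N P" "C \<noteq> D"
      and p: "p \<in> trade_prices N P lam C" "p \<in> trade_prices N P lam D"
      unfolding cluster_price_ties_def by blast
    have kkt: "p2p_kkt UNIV N a (($) v) d P lam"
      using sol by (simp add: p2p_solution_def)
    have "p = price_formula a (($) v) A"
      if "A \<in> trade_clusters N P" "p \<in> trade_prices N P lam A" for A
      using that closed_connected_prices(3)[where a = a, OF m a kkt d trade_cluster_closed[OF that(1)]
          trade_cluster_connected[OF m kkt that(1)]]
      by (auto simp: trade_prices_def)
    then have "v \<in> H (C, D)"
      using CD p by (simp add: H_def)
    moreover have "(C, D) \<in> K"
      using partition_on_trade_clusters[OF m kkt] CD
      by (auto simp: K_def partition_on_def disjoint_def)
    ultimately show "v \<in> (\<Union>p\<in>K. H p)"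
      by blast
  qed
  moreover have "closed (\<Union>p\<in>K. H p)" "negligible (\<Union>p\<in>K. H p)"
    using H by (auto intro!: closed_UN negligible_Union)
  ultimately show ?thesis
    by (meson closure_minimal negligible_subset)
qed

section \<open>Dependence of the prices on the trade weights\<close>

text \<open>All trades of one peer have the same sign, so nothing cancels in its total, and the
  bounds on the total also bound every single trade.\<close>

lemma abs_power_le:
  fixes N :: "'n::finite \<Rightarrow> 'n set"
  assumes feas: "p2p_feasible UNIV B N Pmin Pmax P" and j: "j \<in> N i"
  shows "\<bar>P i j\<bar> \<le> \<bar>Pmin i\<bar> + \<bar>Pmax i\<bar>"
proof -
  have "\<bar>P i j\<bar> \<le> (\<Sum>j\<in>N i. \<bar>P i j\<bar>)"
    using j by (intro member_le_sum) auto
  also have "\<dots> = \<bar>traded_power N P i\<bar>"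
  proof (cases "i \<in> B")
    case True
    then have "\<And>j. j \<in> N i \<Longrightarrow> 0 \<le> P i j"
      using feas by (auto simp: p2p_feasible_def)
    then show ?thesis
      by (simp add: traded_power_def sum_nonneg)
  next
    case False
    then have "\<And>j. j \<in> N i \<Longrightarrow> P i j \<le> 0"
      using feas by (auto simp: p2p_feasible_def)
    then show ?thesis
      by (simp add: traded_power_def sum_nonpos sum_negf)
  qed
  also have "\<dots> \<le> \<bar>Pmin i\<bar> + \<bar>Pmax i\<bar>"
    using feas unfolding p2p_feasible_def by (smt (verit) UNIV_I)
  finally show ?thesis .
qed

text \<open>Testing the difference of the two stationarity conditions with the antisymmetric difference
  of the two trades removes the prices, which are symmetric.\<close>

lemma traded_power_stability:
  fixes N :: "'n::finite \<Rightarrow> 'n set"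
  assumes m: "market UNIV N" and a: "\<And>i. a i > 0"
    and sol: "p2p_solution UNIV B N a b d Pmin Pmax P lam"
    and sol': "p2p_solution UNIV B N a b d' Pmin Pmax P' lam'"
  shows "2 * a i * (traded_power N P i - traded_power N P' i)\<^sup>2
    \<le> (\<Sum>i\<in>UNIV. \<Sum>j\<in>N i. \<bar>d i j - d' i j\<bar> * (2 * (\<bar>Pmin i\<bar> + \<bar>Pmax i\<bar>)))"
proof -
  have feas: "p2p_feasible UNIV B N Pmin Pmax P" "p2p_feasible UNIV B N Pmin Pmax P'"
    and kkt: "p2p_kkt UNIV N a b d P lam" "p2p_kkt UNIV N a b d' P' lam'"
    using sol sol' a p2p_solution_iff[OF m, of a] by (auto simp: less_imp_le)
  let ?t = "\<lambda>i. traded_power N P i - traded_power N P' i"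
  let ?p = "\<lambda>i j. P i j - P' i j"
  have "0 = (\<Sum>i\<in>UNIV. \<Sum>j\<in>N i. (lam i j - lam' i j) * ?p i j)"
  proof (rule sum_edges_antisym[OF m, symmetric])
    fix i j assume "j \<in> N i"
    then have "lam j i = lam i j" "lam' j i = lam' i j" "P j i = - P i j" "P' j i = - P' i j"
      using p2p_kkt_edge[where N = N, OF kkt(1)] p2p_kkt_edge[where N = N, OF kkt(2)] by auto
    then show "(lam j i - lam' j i) * ?p j i = - ((lam i j - lam' i j) * ?p i j)"
      by (simp add: algebra_simps)
  qed
  also have "\<dots> = (\<Sum>i\<in>UNIV. \<Sum>j\<in>N i. 2 * a i * ?t i * ?p i j + (d i j - d' i j) * ?p i j)"
  proof (intro sum.cong refl)
    fix i j assume "j \<in> N i"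
    then have "lam i j = 2 * a i * traded_power N P i + b i + d i j"
        "lam' i j = 2 * a i * traded_power N P' i + b i + d' i j"
      by (rule p2p_kkt_edge[OF kkt(1) UNIV_I], rule p2p_kkt_edge[OF kkt(2) UNIV_I])
    then show "(lam i j - lam' i j) * ?p i j = 2 * a i * ?t i * ?p i j + (d i j - d' i j) * ?p i j"
      by (simp add: algebra_simps)
  qed
  \<comment> \<open>The factor \<open>2 * a i * ?t i\<close> does not depend on \<open>j\<close>,
    and the differences \<open>?p i j\<close> add up to \<open>?t i\<close>; this produces the
    squares.\<close>
  also have "\<dots> = (\<Sum>i\<in>UNIV. 2 * a i * ?t i * ?t i) + (\<Sum>i\<in>UNIV. \<Sum>j\<in>N i. (d i j - d' i j) * ?p i j)"
    by (simp only: sum.distrib sum_subtractf traded_power_def flip: sum_distrib_left)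
  finally have "(\<Sum>i\<in>UNIV. 2 * a i * (?t i)\<^sup>2) = (\<Sum>i\<in>UNIV. \<Sum>j\<in>N i. - ((d i j - d' i j) * ?p i j))"
    by (simp add: power2_eq_square sum_negf mult.assoc)
  also have "\<dots> \<le> (\<Sum>i\<in>UNIV. \<Sum>j\<in>N i. \<bar>d i j - d' i j\<bar> * (2 * (\<bar>Pmin i\<bar> + \<bar>Pmax i\<bar>)))"
  proof (intro sum_mono)
    fix i j assume j: "j \<in> N i"
    have "\<bar>?p i j\<bar> \<le> 2 * (\<bar>Pmin i\<bar> + \<bar>Pmax i\<bar>)"
      using abs_power_le[where N = N, OF feas(1) j] abs_power_le[where N = N, OF feas(2) j]
        abs_triangle_ineq4[of "P i j" "P' i j"] by argo
    then have "\<bar>(d i j - d' i j) * ?p i j\<bar> \<le> \<bar>d i j - d' i j\<bar> * (2 * (\<bar>Pmin i\<bar> + \<bar>Pmax i\<bar>))"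
      unfolding abs_mult by (rule mult_left_mono) simp
    then show "- ((d i j - d' i j) * ?p i j) \<le> \<bar>d i j - d' i j\<bar> * (2 * (\<bar>Pmin i\<bar> + \<bar>Pmax i\<bar>))"
      by linarith
  qed
  finally have *: "(\<Sum>i\<in>UNIV. 2 * a i * (?t i)\<^sup>2) \<le> \<dots>" .
  have "2 * a i * (?t i)\<^sup>2 \<le> (\<Sum>i\<in>UNIV. 2 * a i * (?t i)\<^sup>2)"
    using a by (intro member_le_sum) (auto simp: less_imp_le)
  with * show ?thesis
    by linarith
qed

text \<open>For equal weights the stability bound is zero. Only totals are compared: around a cycle
  of the graph the individual trades of two solutions can differ.\<close>

lemma traded_power_unique:
  fixes N :: "'n::finite \<Rightarrow> 'n set"
  assumes m: "market UNIV N" and a: "\<And>i. a i > 0"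
    and sol: "p2p_solution UNIV B N a b d Pmin Pmax P lam"
    and sol': "p2p_solution UNIV B N a b d Pmin Pmax P' lam'"
  shows "traded_power N P = traded_power N P'"
proof
  fix i
  have "2 * a i * (traded_power N P i - traded_power N P' i)\<^sup>2 \<le> 0"
    using traded_power_stability[where a = a, OF assms, of i] by simp
  then show "traded_power N P i = traded_power N P' i"
    using a[of i] by (simp add: mult_le_0_iff)
qed

text \<open>\<open>P\<close> may be any choice of solutions, because the stability bound depends on
  the weights alone.\<close>

lemma continuous_on_traded_power:
  fixes N :: "'n::finite \<Rightarrow> 'n set" and X :: "(real ^ 'n ^ 'n) set"
  assumes m: "market UNIV N" and a: "\<And>i. a i > 0"
    and sol: "\<And>d. d \<in> X \<Longrightarrow> \<exists>lam. p2p_solution UNIV B N a b (\<lambda>i j. d $ i $ j) Pmin Pmax (P d) lam"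
  shows "continuous_on X (\<lambda>d. traded_power N (P d) i)"
  unfolding continuous_on_def
proof
  fix x assume x: "x \<in> X"
  \<comment> \<open>Square root of the stability bound divided by \<open>2 * a i\<close>: a
    continuous majorant of the change in total power that vanishes at \<open>x\<close>.\<close>
  define h where "h d = sqrt ((\<Sum>i\<in>UNIV. \<Sum>j\<in>N i.
    \<bar>d $ i $ j - x $ i $ j\<bar> * (2 * (\<bar>Pmin i\<bar> + \<bar>Pmax i\<bar>))) / (2 * a i))" for d
  have "isCont h x"
    unfolding h_def by (intro continuous_intros) (use a[of i] in auto)
  moreover have "h x = 0"
    by (simp add: h_def)
  ultimately have h: "(h \<longlongrightarrow> 0) (at x within X)"
    by (metis continuous_at_imp_continuous_at_within continuous_within)
  show "((\<lambda>d. traded_power N (P d) i) \<longlongrightarrow> traded_power N (P x) i) (at x within X)"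
  proof (rule Lim_transform2[OF tendsto_const])
    show "((\<lambda>d. traded_power N (P x) i - traded_power N (P d) i) \<longlongrightarrow> 0) (at x within X)"
    proof (rule Lim_null_comparison[OF _ h])
      have "norm (traded_power N (P x) i - traded_power N (P d) i) \<le> h d" if d: "d \<in> X" for d
      proof -
        let ?t = "traded_power N (P d) i - traded_power N (P x) i"
        obtain l l' where "p2p_solution UNIV B N a b (\<lambda>i j. d $ i $ j) Pmin Pmax (P d) l"
          "p2p_solution UNIV B N a b (\<lambda>i j. x $ i $ j) Pmin Pmax (P x) l'"
          using sol d x by blast
        from traded_power_stability[where a = a, OF m a this, of i]
        have "?t\<^sup>2 \<le> (\<Sum>i\<in>UNIV. \<Sum>j\<in>N i.
          \<bar>d $ i $ j - x $ i $ j\<bar> * (2 * (\<bar>Pmin i\<bar> + \<bar>Pmax i\<bar>))) / (2 * a i)"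
          using a[of i] by (simp add: pos_le_divide_eq mult.commute)
        then have "\<bar>?t\<bar> \<le> h d"
          unfolding h_def by (rule real_le_rsqrt[of "\<bar>?t\<bar>", simplified])
        then show ?thesis
          by (simp add: abs_minus_commute)
      qed
      then show "\<forall>\<^sub>F d in at x within X. norm (traded_power N (P x) i - traded_power N (P d) i) \<le> h d"
        by (auto simp: eventually_at_filter)
    qed
  qed
qed

text \<open>A symmetric change of the weights adds the same amount at both ends of an edge, so the
  price absorbs it.\<close>

lemma p2p_solution_shift:
  fixes N :: "'n::finite \<Rightarrow> 'n set"
  assumes m: "market UNIV N" and a: "\<And>i. a i > 0"
    and sol: "p2p_solution UNIV B N a b d Pmin Pmax P lam"
    and w: "\<And>i j. w i j = w j i"
  shows "p2p_solution UNIV B N a b (\<lambda>i j. d i j + w i j) Pmin Pmax P (\<lambda>i j. lam i j + w i j)"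
proof -
  have feas: "p2p_feasible UNIV B N Pmin Pmax P" and kkt: "p2p_kkt UNIV N a b d P lam"
    using sol a p2p_solution_iff[OF m, of a] by (auto simp: less_imp_le)
  have "p2p_kkt UNIV N a b (\<lambda>i j. d i j + w i j) P (\<lambda>i j. lam i j + w i j)"
    unfolding p2p_kkt_iff
  proof (intro ballI)
    fix i j assume "j \<in> N i"
    note E = p2p_kkt_edge[OF kkt UNIV_I this]
    show "P i j + P j i = 0 \<and> lam i j + w i j = lam j i + w j i \<and>
        lam i j + w i j = 2 * a i * traded_power N P i + b i + (d i j + w i j)"
      using E w[of i j] by linarith
  qed
  with feas show ?thesis
    using a p2p_solution_iff[OF m, of a] by (auto simp: less_imp_le)
qed

lemma eventually_affine_neq_0:
  fixes x y :: real
  assumes "y \<noteq> 0"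
  shows "\<forall>\<^sub>F e in at 0. x + e * y \<noteq> 0"
proof -
  \<comment> \<open>For \<open>x = 0\<close> the only bad value is 0 itself, which the punctured
    filter excludes.\<close>
  have "\<forall>\<^sub>F e in at 0. e \<noteq> - x / y"
    by (rule eventually_neq_at_within)
  then show ?thesis
    by eventually_elim (use assms in \<open>auto simp: field_simps eq_neg_iff_add_eq_0\<close>)
qed

text \<open>Distinct labels on unordered pairs separate tied prices; nonzero labels allow the
  perturbed weights to stay nonzero.\<close>

lemma ex_edge_labels:
  "\<exists>w :: 'n::finite \<Rightarrow> 'n \<Rightarrow> real. (\<forall>i j. w i j = w j i) \<and> (\<forall>i j. w i j \<noteq> 0) \<and>
     (\<forall>i j k l. w i j = w k l \<longrightarrow> {i, j} = {k, l})"
proof -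
  obtain f :: "'n set \<Rightarrow> nat" where f: "inj f"
    using finite_imp_inj_to_nat_seg[of "UNIV :: 'n set set"] by auto
  show ?thesis
    \<comment> \<open>Using the set \<open>{i, j}\<close> makes the label symmetric, injectivity of
      \<open>f\<close> makes it distinct, and adding 1 makes it nonzero.\<close>
    by (rule exI[of _ "\<lambda>i j. 1 + real (f {i, j})"])
      (use f in \<open>auto simp: insert_commute inj_eq add_eq_0_iff simp del: of_nat_Suc\<close>)
qed

text \<open>Adding a symmetric matrix to the weights keeps the trades and moves the prices by the same
  matrix, so every solvable weight can be moved off the closed set of ties.\<close>

lemma nowhere_dense_transaction_price_ties:
  fixes N :: "'n::finite \<Rightarrow> 'n set"
  assumes m: "market UNIV N" and a: "\<And>i. a i > 0"
  shows "nowhere_dense_in (solvable_weights B N a b Pmin Pmax)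
           (transaction_price_ties B N a b Pmin Pmax)"
proof -
  define X where "X = solvable_weights B N a b Pmin Pmax"
  define A where "A = transaction_price_ties B N a b Pmin Pmax"
  let ?sol = "\<lambda>d. p2p_solution UNIV B N a b (\<lambda>i j. d $ i $ j) Pmin Pmax"
  have "\<forall>d\<in>X. \<exists>P. \<exists>lam. ?sol d P lam"
    by (auto simp: X_def solvable_weights_def)
  then obtain P where P: "\<And>d. d \<in> X \<Longrightarrow> \<exists>lam. ?sol d (P d) lam"
    using bchoice by metis
  \<comment> \<open>The price as a function of the weights alone: since totals are unique, on an
    edge it is the price in every solution, not only in the chosen \<open>P d\<close>.\<close>
  define L where "L i j d = 2 * a i * traded_power N (P d) i + b i + d $ i $ j" for i j d
  have L: "lam i j = L i j d" if "d \<in> X" "?sol d P' lam" "j \<in> N i" for d P' lam i j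
  proof -
    have "traded_power N P' = traded_power N (P d)"
      using that(1,2) P traded_power_unique[where a = a, OF m a] by metis
    moreover have kkt: "p2p_kkt UNIV N a b (\<lambda>i j. d $ i $ j) P' lam"
      using that(2) by (simp add: p2p_solution_def)
    ultimately show ?thesis
      using p2p_kkt_edge(3)[where N = N, OF kkt UNIV_I that(3)] by (simp add: L_def)
  qed
  define Q where "Q = {((i, j), (k, l)). j \<in> N i \<and> l \<in> N k \<and> {i, j} \<noteq> {k, l}}"
  \<comment> \<open>Ties between any two distinct edges are collected, traded or not. Which edges
    trade varies with the solution, whereas \<open>F\<close> is a finite union of relatively closed
    zero sets.\<close>
  define F where "F = (\<Union>((i, j), (k, l))\<in>Q. {d \<in> X. L i j d - L k l d = 0})"
  have cont: "continuous_on X (L i j)" for i j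
    unfolding L_def by (intro continuous_intros continuous_on_traded_power[where a = a, OF m a P])
  have "closedin (top_of_set X) {d \<in> X. L i j d - L k l d = 0}" for i j k l
    by (intro continuous_closedin_preimage_constant continuous_on_diff cont)
  then have "closedin (top_of_set X) F"
    unfolding F_def by (intro closedin_Union) (auto simp del: right_minus_eq)
  moreover have "A \<subseteq> F"
  proof
    fix d assume "d \<in> A"
    then obtain P' lam i j k l where "d \<in> X" "?sol d P' lam" "traded N P' i j" "traded N P' k l"
      "{i, j} \<noteq> {k, l}" "lam i j = lam k l"
      unfolding A_def transaction_price_ties_def X_def by blast
    then show "d \<in> F"
      using L[of d P' lam] by (fastforce simp: F_def Q_def traded_def)
  qed
  ultimately have cl: "(top_of_set X) closure_of A \<subseteq> F"
    by (simp add: closure_of_minimal)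
  obtain w :: "'n \<Rightarrow> 'n \<Rightarrow> real" where w: "\<And>i j. w i j = w j i" "\<And>i j. w i j \<noteq> 0"
    "\<And>i j k l. w i j = w k l \<Longrightarrow> {i, j} = {k, l}"
    using ex_edge_labels by metis
  have "d \<notin> (top_of_set X) interior_of ((top_of_set X) closure_of A)" for d
  proof
    assume "d \<in> (top_of_set X) interior_of ((top_of_set X) closure_of A)"
    then obtain U where U: "openin (top_of_set X) U" "d \<in> U" "U \<subseteq> F"
      using cl by (auto simp: interior_of_def)
    then obtain V where V: "open V" "U = X \<inter> V"
      by (metis openin_open)
    have "d \<in> X"
      using U V by auto
    then obtain lam where sol: "?sol d (P d) lam"
      using P by blast
    \<comment> \<open>The line of perturbed weights through \<open>d\<close>; along it the trades
      \<open>P d\<close> stay a solution and the prices become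
      \<open>lam i j + e * w i j\<close>.\<close>
    define D where "D e = (\<chi> i j. d $ i $ j + e * w i j)" for e
    have "isCont D 0"
      unfolding D_def isCont_def by (intro tendsto_vec_lambda tendsto_intros)
    moreover have "D 0 = d"
      by (simp add: D_def vec_eq_iff)
    ultimately have "\<forall>\<^sub>F e in at 0. D e \<in> V"
      using V U by (metis IntD2 isCont_def topological_tendstoD)
    \<comment> \<open>Solvable weights must be nonzero on some edge, so small \<open>e\<close> are
      chosen for which the shift does not cancel the weight on this one.\<close>
    moreover obtain i0 j0 where "j0 \<in> N i0"
      using \<open>d \<in> X\<close> by (auto simp: X_def solvable_weights_def)
    moreover have "\<forall>\<^sub>F e in at 0. d $ i0 $ j0 + e * w i0 j0 \<noteq> 0"
      using w(2) by (rule eventually_affine_neq_0)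
    moreover have "\<forall>\<^sub>F e in at 0. \<forall>q\<in>Q. case q of ((i, j), (k, l)) \<Rightarrow>
        (lam i j - lam k l) + e * (w i j - w k l) \<noteq> 0"
    proof (intro eventually_ball_finite ballI)
      fix q assume "q \<in> Q"
      obtain i j k l where q: "q = ((i, j), (k, l))"
        by (metis surj_pair)
      with \<open>q \<in> Q\<close> have "w i j - w k l \<noteq> 0"
        using w(3)[of i j k l] by (auto simp: Q_def)
      then show "\<forall>\<^sub>F e in at 0. case q of ((i, j), (k, l)) \<Rightarrow>
        (lam i j - lam k l) + e * (w i j - w k l) \<noteq> 0"
        unfolding q by (simp add: eventually_affine_neq_0)
    qed simp
    ultimately have "\<forall>\<^sub>F e in at 0. D e \<in> V \<and> d $ i0 $ j0 + e * w i0 j0 \<noteq> 0 \<and>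
        (\<forall>q\<in>Q. case q of ((i, j), (k, l)) \<Rightarrow> (lam i j - lam k l) + e * (w i j - w k l) \<noteq> 0)"
      by (auto intro: eventually_conj)
    then obtain e where e: "D e \<in> V" "d $ i0 $ j0 + e * w i0 j0 \<noteq> 0"
        "\<forall>q\<in>Q. case q of ((i, j), (k, l)) \<Rightarrow> (lam i j - lam k l) + e * (w i j - w k l) \<noteq> 0"
      using eventually_happens'[OF at_neq_bot[of "0::real"]] by blast
    have sol': "?sol (D e) (P d) (\<lambda>i j. lam i j + e * w i j)"
      using p2p_solution_shift[where a = a, OF m a sol, of "\<lambda>i j. e * w i j"] w(1) by (simp add: D_def)
    have "\<exists>i. \<exists>j\<in>N i. D e $ i $ j \<noteq> 0"
      using e(2) \<open>j0 \<in> N i0\<close> by (auto simp: D_def)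
    with sol' have DX: "D e \<in> X"
      unfolding X_def solvable_weights_def by blast
    then have "D e \<in> F"
      using U V e(1) by blast
    then obtain i j k l where q: "((i, j), (k, l)) \<in> Q" "L i j (D e) = L k l (D e)"
      by (auto simp: F_def)
    then have "lam i j + e * w i j = lam k l + e * w k l"
      using L[OF DX sol'] by (simp add: Q_def)
    \<comment> \<open>The tie found in \<open>F\<close> contradicts the choice of \<open>e\<close>,
      which separates the shifted prices of all pairs in \<open>Q\<close>.\<close>
    then show False
      using e(3) q(1) by (force simp: algebra_simps)
  qed
  then show ?thesis
    unfolding nowhere_dense_in_def X_def A_def by blast
qed

section \<open>The incidence system\<close>

lemma append_column_mult_vec:
  fixes E :: "real ^ 'e::finite ^ 'n::finite"
  shows "transpose (append_column E v) *v x = append_entry (transpose E *v x) (v \<bullet> x)"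
  by (simp add: vec_eq_iff append_column_def append_entry_def transpose_def matrix_vector_mult_def
      inner_vec_def split: option.split)

lemma append_entry_eq_iff:
  "append_entry v z = append_entry v' z' \<longleftrightarrow> v = v' \<and> z = z'"
  by (auto simp: vec_eq_iff append_entry_def split_option_all)

text \<open>Since the edge is no loop, the nested conditional of \<open>incidence_matrix\<close> is
  the difference of two indicators.\<close>

lemma incidence_transpose_mult_vec:
  fixes edge :: "'e::finite \<Rightarrow> 'n::finite \<times> 'n"
  assumes "fst (edge e) \<noteq> snd (edge e)"
  shows "(transpose (incidence_matrix edge) *v x) $ e = x $ fst (edge e) - x $ snd (edge e)"
proof -
  have "(transpose (incidence_matrix edge) *v x) $ e
      = (\<Sum>i\<in>UNIV. (if i = fst (edge e) then x $ i else 0) - (if i = snd (edge e) then x $ i else 0))"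
    unfolding matrix_vector_mult_def transpose_def incidence_matrix_def
    using assms by (auto intro!: sum.cong)
  then show ?thesis
    by (simp add: sum_subtractf)
qed

text \<open>The row of an edge says that its price is the same seen from both ends. Reversing the
  orientation negates both sides of that row, so every orientation gives the same system.\<close>

lemma incidence_system_iff:
  fixes edge :: "'e::finite \<Rightarrow> 'n::finite \<times> 'n"
  assumes graph: "p2p_graph B N" and edge: "edge_orientation N edge"
  shows "transpose (append_column (incidence_matrix edge) v) *v x
      = append_entry (edge_vec edge b d) 0
    \<longleftrightarrow> (\<forall>i. \<forall>j\<in>N i. x $ i + b i + d i j = x $ j + b j + d j i) \<and> v \<bullet> x = 0"
proof -
  have "fst (edge e) \<noteq> snd (edge e)" for e
    using graph edge unfolding p2p_graph_def edge_orientation_def by metis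
  then have "transpose (incidence_matrix edge) *v x = edge_vec edge b d \<longleftrightarrow>
      (\<forall>e. x $ fst (edge e) - x $ snd (edge e) = edge_vec edge b d $ e)"
    by (simp add: vec_eq_iff incidence_transpose_mult_vec del: transpose_matrix_vector)
  also have "\<dots> \<longleftrightarrow> (\<forall>e i j. edge e = (i, j) \<longrightarrow> x $ i + b i + d i j = x $ j + b j + d j i)"
    by (rule all_cong1) (auto simp: edge_vec_def algebra_simps split: prod.split)
  also have "\<dots> \<longleftrightarrow> (\<forall>i. \<forall>j\<in>N i. x $ i + b i + d i j = x $ j + b j + d j i)"
    using edge unfolding edge_orientation_def by (metis fst_conv snd_conv)
  finally show ?thesis
    by (simp add: append_column_mult_vec append_entry_eq_iff del: transpose_matrix_vector)
qed

text \<open>The difference of two solutions is constant along edges, hence constant on a connected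
  graph, and the last row with its positive coefficients forces the constant to be 0.\<close>

lemma incidence_system_unique:
  fixes x y :: "real ^ 'n::finite"
  assumes a: "\<And>i. a i > 0" and conn: "connected_graph UNIV (\<lambda>i j. j \<in> N i)"
    and x: "\<forall>i. \<forall>j\<in>N i. x $ i + b i + d i j = x $ j + b j + d j i"
    and y: "\<forall>i. \<forall>j\<in>N i. y $ i + b i + d i j = y $ j + b j + d j i"
    and sum: "(\<chi> i. 1 / (2 * a i)) \<bullet> x = 0" "(\<chi> i. 1 / (2 * a i)) \<bullet> y = 0"
  shows "x = y"
proof -
  let ?z = "\<lambda>i. x $ i - y $ i"
  have step: "?z i = ?z j" if "j \<in> N i" for i j
    using x[rule_format, OF that] y[rule_format, OF that] by linarith
  have const: "?z i = ?z k" for i k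
    by (rule connected_graph_const[where f = ?z, OF conn step]) auto
  have "?z k = 0" for k
  proof -
    have "0 = (\<Sum>i\<in>UNIV. 1 / (2 * a i) * ?z i)"
      using sum by (simp add: inner_vec_def right_diff_distrib sum_subtractf diff_divide_distrib)
    also have "\<dots> = (\<Sum>i\<in>UNIV. 1 / (2 * a i)) * ?z k"
      unfolding sum_distrib_right by (intro sum.cong refl arg_cong2[where f = "(*)"] const)
    finally have "(\<Sum>i\<in>UNIV. 1 / (2 * a i)) * ?z k = 0" ..
    moreover have "(\<Sum>i\<in>UNIV. 1 / (2 * a i)) > 0"
      using a by (intro sum_pos) auto
    ultimately show ?thesis
      by simp
  qed
  then show ?thesis
    by (simp add: vec_eq_iff)
qed

section \<open>Prices and traded powers in the connected, clustered and weighted cases\<close>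

theorem theorem1:
  fixes B :: "'n::finite set" and N :: "'n \<Rightarrow> 'n set"
    and a b Pmin Pmax :: "'n \<Rightarrow> real"
    and d P lam :: "'n \<Rightarrow> 'n \<Rightarrow> real"
  defines "S \<equiv> traded_peers UNIV N P"
  assumes graph: "p2p_graph B N"
    and a_pos: "\<And>i. a i > 0"
    and sol: "p2p_solution UNIV B N a b d Pmin Pmax P lam"
  shows
    "((\<forall>i. \<forall>j\<in>N i. d i j = 0) \<and> connected_graph S (traded N P) \<longrightarrow>
        (\<forall>i j. traded N P i j \<longrightarrow> lam i j = price_formula a b S) \<and>
        (\<forall>i\<in>S. traded_power N P i = power_formula a b S i) \<and>
        (\<forall>I. I = S \<or> I = UNIV \<and> connected_graph UNIV (\<lambda>i j. j \<in> N i) \<longrightarrow>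
           (\<forall>Q. pool_optimal I B a b Pmin Pmax Q \<longleftrightarrow> (\<forall>i\<in>I. Q i = traded_power N P i)) \<and>
           pool_price I a b (traded_power N P) (price_formula a b S)))
     \<and>
     ((\<forall>i. \<forall>j\<in>N i. d i j = 0) \<and> S \<noteq> {} \<and> \<not> connected_graph S (traded N P) \<longrightarrow>
        2 \<le> card (trade_clusters N P) \<and>
        partition_on S (trade_clusters N P) \<and>
        (\<forall>C\<in>trade_clusters N P.
           p2p_solution C B (submarket N C) a b d Pmin Pmax P lam \<and>
           traded_peers C (submarket N C) P = C \<and>
           connected_graph C (traded (submarket N C) P) \<and>
           (\<forall>i\<in>C. \<forall>j. traded N P i j \<longrightarrow> j \<in> C \<and> lam i j = price_formula a b C) \<and>
           (\<forall>i\<in>C. traded_power N P i = power_formula a b C i)) \<and>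
        negligible (closure (cluster_price_ties B N a d Pmin Pmax)))
     \<and>
     ((\<exists>i. \<exists>j\<in>N i. d i j \<noteq> 0) \<longrightarrow>
        (\<forall>i j k. traded N P i j \<and> traded N P i k \<longrightarrow> (lam i j = lam i k \<longleftrightarrow> d i j = d i k)) \<and>
        nowhere_dense_in (solvable_weights B N a b Pmin Pmax)
                         (transaction_price_ties B N a b Pmin Pmax) \<and>
        (\<forall>edge :: 'e::finite \<Rightarrow> 'n \<times> 'n. edge_orientation N edge \<longrightarrow>
           (let M = transpose (append_column (incidence_matrix edge) (\<chi> i. 1 / (2 * a i)));
                rhs = append_entry (edge_vec edge b d) 0;
                Ptr = (\<chi> i. 2 * a i * traded_power N P i)
            in M *v Ptr = rhs \<and>
               (connected_graph UNIV (\<lambda>i j. j \<in> N i) \<longrightarrow> (\<forall>x. M *v x = rhs \<longrightarrow> x = Ptr)))))"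
proof -
  have m: "market UNIV N"
    using graph by (rule market_UNIV)
  have feas: "p2p_feasible UNIV B N Pmin Pmax P" and kkt: "p2p_kkt UNIV N a b d P lam"
    using sol a_pos p2p_solution_iff[OF m, of a] by (auto simp: less_imp_le)
  let ?T = "traded_power N P"
  have S_closed: "\<forall>i\<in>S. \<forall>j. traded N P i j \<longrightarrow> j \<in> S"
    using traded_sym[OF m kkt] by (auto simp: S_def traded_peers_def)
  have in_S: "i \<in> S" if "traded N P i j" for i j
    using that by (auto simp: S_def traded_peers_def)
  have T_sign: "if i \<in> B then 0 \<le> ?T i else ?T i \<le> 0" for i
    using feas by (auto simp: p2p_feasible_def traded_power_def intro: sum_nonneg sum_nonpos)
  have T_sum: "(\<Sum>i\<in>UNIV. ?T i) = 0"
    by (rule sum_traded_power[OF m]) (use kkt in \<open>auto simp: p2p_kkt_def\<close>)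
  have KKT: "P i j + P j i = 0" "lam i j = lam j i" "lam i j = 2 * a i * ?T i + b i + d i j"
    if "j \<in> N i" for i j
    using p2p_kkt_edge[OF kkt UNIV_I that] by auto
  have sym: "i \<in> N j" if "j \<in> N i" for i j
    using m that by (auto simp: market_def)
  have 1: "(\<forall>i j. traded N P i j \<longrightarrow> lam i j = price_formula a b S) \<and>
        (\<forall>i\<in>S. ?T i = power_formula a b S i) \<and>
        (\<forall>I. I = S \<or> I = UNIV \<and> connected_graph UNIV (\<lambda>i j. j \<in> N i) \<longrightarrow>
           (\<forall>Q. pool_optimal I B a b Pmin Pmax Q \<longleftrightarrow> (\<forall>i\<in>I. Q i = ?T i)) \<and>
           pool_price I a b ?T (price_formula a b S))"
    if d: "\<forall>i. \<forall>j\<in>N i. d i j = 0" and conn: "connected_graph S (traded N P)"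
  proof -
    note F = closed_connected_prices[where a = a, OF m a_pos kkt d S_closed conn]
    let ?mu = "price_formula a b S"
    \<comment> \<open>For a general \<open>I\<close>, because the comparison is made both with the
      pool of the traded peers and with the pool of all peers.\<close>
    have pool: "(\<forall>Q. pool_optimal I B a b Pmin Pmax Q \<longleftrightarrow> (\<forall>i\<in>I. Q i = ?T i)) \<and> pool_price I a b ?T ?mu"
      if "(\<Sum>i\<in>I. ?T i) = 0" and mu: "\<And>i. i \<in> I \<Longrightarrow> 2 * a i * ?T i + b i = ?mu" for I
    proof -
      have "pool_feasible I B Pmin Pmax ?T"
        using that feas T_sign by (auto simp: pool_feasible_def p2p_feasible_def)
      then show ?thesis
        using pool_optimal_iff[of a, OF a_pos _ mu] pool_cost_has_derivative mu
        by (metis pool_price_def)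
    qed
    \<comment> \<open>The KKT equations hold on every edge, traded or not. In a connected
      communication graph the marginal cost of the traded peers therefore reaches also the peers
      that do not trade.\<close>
    have "2 * a i * ?T i + b i = ?mu" if U: "connected_graph UNIV (\<lambda>i j. j \<in> N i)" for i
    proof -
      have step: "2 * a i * ?T i + b i = 2 * a j * ?T j + b j" if "j \<in> N i" for i j
        using KKT[OF that] KKT[OF sym[OF that]] d that sym[OF that] by simp
      obtain s where "s \<in> S"
        using conn by (auto simp: connected_graph_def)
      then show ?thesis
        using F(1) connected_graph_const[where f = "\<lambda>i. 2 * a i * ?T i + b i", OF U step, of i s]
        by simp
    qed
    then show ?thesis
      using F in_S pool T_sum sum_traded_power_closed(2)[OF m kkt S_closed] by blast
  qed
  have 2: "2 \<le> card (trade_clusters N P) \<and>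
        partition_on S (trade_clusters N P) \<and>
        (\<forall>C\<in>trade_clusters N P.
           p2p_solution C B (submarket N C) a b d Pmin Pmax P lam \<and>
           traded_peers C (submarket N C) P = C \<and>
           connected_graph C (traded (submarket N C) P) \<and>
           (\<forall>i\<in>C. \<forall>j. traded N P i j \<longrightarrow> j \<in> C \<and> lam i j = price_formula a b C) \<and>
           (\<forall>i\<in>C. ?T i = power_formula a b C i)) \<and>
        negligible (closure (cluster_price_ties B N a d Pmin Pmax))"
    if d: "\<forall>i. \<forall>j\<in>N i. d i j = 0" and S: "S \<noteq> {}" "\<not> connected_graph S (traded N P)"
  proof (intro conjI ballI)
    show "2 \<le> card (trade_clusters N P)"
      using two_le_card_trade_clusters S by (auto simp: S_def)
    show part: "partition_on S (trade_clusters N P)"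
      unfolding S_def by (rule partition_on_trade_clusters[OF m kkt])
    show "negligible (closure (cluster_price_ties B N a d Pmin Pmax))"
      using negligible_closure_cluster_price_ties[where a = a, OF m a_pos] d by blast
    fix C assume C: "C \<in> trade_clusters N P"
    note closed = trade_cluster_closed[OF C] and conn = trade_cluster_connected[OF m kkt C]
    note F = closed_connected_prices[where a = a, OF m a_pos kkt d closed conn]
    show "p2p_solution C B (submarket N C) a b d Pmin Pmax P lam"
      by (rule submarket_solution[where a = a, OF m a_pos sol closed])
    have "C \<subseteq> S"
      using part C by (auto simp: partition_on_def)
    then show "traded_peers C (submarket N C) P = C"
      using closed by (fastforce simp: S_def traded_peers_def traded_def submarket_def)
    show "connected_graph C (traded (submarket N C) P)"
      by (rule connected_submarket[OF conn closed])
    show "\<forall>j. traded N P i j \<longrightarrow> j \<in> C \<and> lam i j = price_formula a b C" if "i \<in> C" for i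
      using that F closed by blast
    show "?T i = power_formula a b C i" if "i \<in> C" for i
      using that F(2) by blast
  qed
  \<comment> \<open>Two transactions of the same peer share its marginal cost, so their prices
    differ exactly by their weights.\<close>
  have 3: "lam i j = lam i k \<longleftrightarrow> d i j = d i k" if "traded N P i j" "traded N P i k" for i j k
    using that KKT(3) by (simp add: traded_def)
  have 4: "let M = transpose (append_column (incidence_matrix edge) (\<chi> i. 1 / (2 * a i)));
                rhs = append_entry (edge_vec edge b d) 0;
                Ptr = (\<chi> i. 2 * a i * ?T i)
            in M *v Ptr = rhs \<and>
               (connected_graph UNIV (\<lambda>i j. j \<in> N i) \<longrightarrow> (\<forall>x. M *v x = rhs \<longrightarrow> x = Ptr))"
    if "edge_orientation N edge" for edge :: "'e \<Rightarrow> 'n \<times> 'n"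
  proof -
    let ?Ptr = "\<chi> i. 2 * a i * ?T i"
    have stat: "\<forall>i. \<forall>j\<in>N i. ?Ptr $ i + b i + d i j = ?Ptr $ j + b j + d j i"
      using KKT(2,3) sym by (metis vec_lambda_beta)
    have "a i \<noteq> 0" for i
      using a_pos[of i] by simp
    \<comment> \<open>The entries of \<open>\<alpha>\<close> cancel the factors
      \<open>2 * a i\<close>, so the last row of the system is the balance of all traded
      powers.\<close>
    then have bal: "(\<chi> i. 1 / (2 * a i)) \<bullet> ?Ptr = 0"
      using T_sum by (simp add: inner_vec_def)
    have "x = ?Ptr" if "connected_graph UNIV (\<lambda>i j. j \<in> N i)"
        "\<forall>i. \<forall>j\<in>N i. x $ i + b i + d i j = x $ j + b j + d j i"
        "(\<chi> i. 1 / (2 * a i)) \<bullet> x = 0" for x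
      by (rule incidence_system_unique[where a = a, OF a_pos that(1,2) stat that(3) bal])
    then show ?thesis
      unfolding Let_def incidence_system_iff[OF graph that]
      by (intro conjI impI allI stat bal) (elim conjE)
  qed
  note 5 = nowhere_dense_transaction_price_ties[where a = a, OF m a_pos]
  show ?thesis
    by (rule conjI[OF _ conjI]; rule impI; (elim conjE)?)
      (rule 1 2; assumption | intro conjI allI impI 3 4 5; (elim conjE)?; assumption)+
qed

end
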